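(* Let $p$ and $r$ be primes such that $p$ is a primitive root modulo $r$. Then $$g\left(\frac{p^{r-1}-1}{r},\,p^{r-1}\right)=\frac{(p-1)(r-1)}{2}.$$
   Context: For a prime power $q$ and a positive integer $k$, the Waring function $g(k,q)$ is the maximal number of summands needed to express the elements of the finite field $\mathbb{F}_q$ as sums of $k$th powers; that is, $g(k,q)$ is the smallest positive integer $g$ such that every $a\in\mathbb{F}_q$ can be written as $a=\sum_{i=1}^{g}x_i^k$ with $x_1,\ldots,x_g\in\mathbb{F}_q$ (the $x_i$ may be zero). The assertion includes that such a $g$ exists. "$p$ is a primitive root modulo $r$" means that the class of $p$ generates $(\mathbb{Z}/r\mathbb{Z})^*$ (in particular $p\neq r$). *)

theory Defs
  imports "HOL-Number_Theory.Residue_Primitive_Roots" "HOL-Algebra.Ring" "HOL-Algebra.Coset"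
begin

definition all_sums_of_powers :: "('a, 'b) ring_scheme \<Rightarrow> nat \<Rightarrow> nat \<Rightarrow> bool" where
  "all_sums_of_powers R k g \<longleftrightarrow>
     (\<forall>a \<in> carrier R. \<exists>x \<in> {1..g} \<rightarrow> carrier R.
        a = (\<Oplus>\<^bsub>R\<^esub>i\<in>{1..g}. x i [^]\<^bsub>R\<^esub> k))"

text \<open>
  The Waring function g(k,q) is \<open>waring_number R k\<close> for any field \<open>R\<close> with q elements
  (such fields being isomorphic, the choice does not matter). If no admissible number of
  summands exists, the value is unspecified, so existence has to be asserted separately.
\<close>

definition waring_number :: "('a, 'b) ring_scheme \<Rightarrow> nat \<Rightarrow> nat" where
  "waring_number R k = (LEAST g. 0 < g \<and> all_sums_of_powers R k g)"

end

theory Submission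
  imports Defs "HOL-Algebra.Multiplicative_Group"
begin

text \<open>
  The \<open>k\<close>th powers are \<open>0\<close> and the \<open>r\<close>th roots of unity \<open>z ^ j\<close>, \<open>j < r\<close>. As \<open>p\<close> is a primitive
  root modulo \<open>r\<close>, these span the field over its prime field and their only linear relation is that
  they sum to \<open>0\<close>. So the cost of \<open>\<Sum>j<r. n j * z ^ j\<close> is the least digit sum
  \<open>S c = (\<Sum>j<r. (n j + c) mod p)\<close> over all shifts \<open>c\<close>. Since \<open>S c\<close> runs through all residues modulo \<open>p\<close>
  and averages \<open>r * (p - 1) / 2\<close>, its minimum is at most \<open>(p - 1) * (r - 1) / 2\<close>; this is attained for
  the evenly spread digits \<open>n j = p * j div r\<close>.
\<close>

section \<open>Arithmetic of shifted digit sums\<close>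

lemma bij_betw_affine_mod:
  fixes a b n :: nat
  assumes "coprime b n" and "n > 0"
  shows "bij_betw (\<lambda>i. (a + b * i) mod n) {..<n} {..<n}"
proof -
  have inj: "inj_on (\<lambda>i. (a + b * i) mod n) {..<n}"
  proof (rule inj_onI)
    fix i j assume ij: "i \<in> {..<n}" "j \<in> {..<n}"
      and "(a + b * i) mod n = (a + b * j) mod n"
    then have "[b * i = b * j] (mod n)"
      by (metis cong_add_lcancel_nat cong_def)
    then have "[i = j] (mod n)"
      using assms by (simp add: cong_mult_lcancel_nat)
    with ij show "i = j"
      by (simp add: cong_def)
  qed
  moreover have "(\<lambda>i. (a + b * i) mod n) ` {..<n} = {..<n}"
    by (rule endo_inj_surj) (use inj assms in auto)
  ultimately show ?thesis
    by (simp add: bij_betw_def)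
qed

lemma double_sum_lessThan: "2 * (\<Sum>i<n. i) = n * (n - 1)" for n :: nat
  by (induction n) (auto simp: algebra_simps diff_mult_distrib2 split: nat_diff_split)

lemma double_sum_affine_mod:
  fixes a b n :: nat
  assumes "coprime b n" and "n > 0"
  shows "2 * (\<Sum>i<n. (a + b * i) mod n) = n * (n - 1)"
  using sum.reindex_bij_betw[OF bij_betw_affine_mod[OF assms, of a], of "\<lambda>i. i"]
  by (simp add: double_sum_lessThan)

text \<open>
  The digit sums of the shifts of \<open>f\<close> are pairwise incongruent modulo \<open>p\<close>, so their average
  exceeds their minimum by at least \<open>(p - 1) / 2\<close>.
\<close>

lemma exists_shift_small_digit_sum:
  fixes f :: "nat \<Rightarrow> nat" and p r :: nat
  assumes "coprime r p" and "p > 0"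
  shows "\<exists>c. 2 * (\<Sum>i<r. (f i + c) mod p) \<le> (p - 1) * (r - 1)"
proof -
  define S where "S c = (\<Sum>i<r. (f i + c) mod p)" for c
  define m where "m = Min (S ` {..<p})"
  have "m \<in> S ` {..<p}"
    unfolding m_def by (rule Min_in) (use \<open>p > 0\<close> in auto)
  then obtain c0 where c0: "m = S c0" by auto
  have m_le: "m \<le> S c" if "c < p" for c
    unfolding m_def using that by (intro Min_le) auto
  have S_cong: "[S c = (\<Sum>i<r. f i) + r * c] (mod p)" for c
  proof -
    have "S c mod p = (\<Sum>i<r. f i + c) mod p"
      by (simp add: S_def mod_sum_eq)
    then show ?thesis
      by (simp add: cong_def sum.distrib)
  qed
  \<comment> \<open>Modulo \<open>p\<close>, adding \<open>(p - 1) * m\<close> subtracts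
    \<open>m\<close> without natural-number subtraction, so \<open>A + r * c\<close> is congruent to
    \<open>S c - m\<close>. As \<open>m \<le> S c\<close>, the residue of \<open>A + r * c\<close>
    is at most \<open>S c - m\<close>.\<close>
  define A where "A = (\<Sum>i<r. f i) + (p - 1) * m"
  have "(A + r * c) mod p \<le> S c - m" if "c < p" for c
  proof -
    have "[A + r * c + m = ((\<Sum>i<r. f i) + r * c) + p * m] (mod p)"
      using \<open>p > 0\<close> by (cases p) (auto simp: A_def algebra_simps)
    then have "[A + r * c + m = S c + 0] (mod p)"
      by (metis (no_types, lifting) S_cong add.right_neutral cong_def mod_mult_self2)
    then have "[A + r * c + m = (S c - m) + m] (mod p)"
      using m_le[OF that] by simp
    then have "[A + r * c = S c - m] (mod p)"
      by (simp only: cong_add_rcancel_nat)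
    then show ?thesis
      by (simp add: cong_def)
  qed
  \<comment> \<open>As \<open>r\<close> is coprime to \<open>p\<close>, the residues of
    \<open>A + r * c\<close> for \<open>c < p\<close> are \<open>0, ..., p - 1\<close> in some
    order. This is where the gain over the trivial bound \<open>m \<le> S c\<close> comes
    from.\<close>
  then have "(\<Sum>c<p. m + (A + r * c) mod p) \<le> (\<Sum>c<p. S c)"
    using m_le by (intro sum_mono) (fastforce simp: le_diff_conv2 add.commute)
  then have "2 * p * m + 2 * (\<Sum>c<p. (A + r * c) mod p) \<le> 2 * (\<Sum>c<p. S c)"
    by (simp add: sum.distrib)
  moreover have "2 * (\<Sum>c<p. S c) = r * (p * (p - 1))"
  proof -
    \<comment> \<open>After swapping the sums, each digit position runs through all residues modulo
      \<open>p\<close> as \<open>c\<close> varies.\<close>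
    have "(\<Sum>c<p. S c) = (\<Sum>i<r. \<Sum>c<p. (f i + 1 * c) mod p)"
      by (simp add: S_def sum.swap[of _ "{..<p}"])
    then have "2 * (\<Sum>c<p. S c) = (\<Sum>i<r. 2 * (\<Sum>c<p. (f i + 1 * c) mod p))"
      by (simp add: sum_distrib_left)
    also have "\<dots> = r * (p * (p - 1))"
      using \<open>p > 0\<close> by (subst double_sum_affine_mod) auto
    finally show ?thesis .
  qed
  ultimately have "p * (2 * m + (p - 1)) \<le> p * (r * (p - 1))"
    using double_sum_affine_mod[OF assms, of A] by (simp add: algebra_simps)
  then have "2 * m + (p - 1) \<le> r * (p - 1)"
    using \<open>p > 0\<close> by simp
  then have "2 * S c0 \<le> (p - 1) * (r - 1)"
    by (simp add: c0 diff_mult_distrib2 mult.commute)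
  then show ?thesis
    unfolding S_def by blast
qed

text \<open>Sum \<open>p * i = r * (p * i div r) + p * i mod r\<close> over \<open>i\<close>: the
  remainders permute \<open>{..<r}\<close>, so only the quotients are unknown.\<close>

lemma double_sum_floor:
  fixes p r :: nat
  assumes "coprime p r" and "r > 0"
  shows "2 * (\<Sum>i<r. p * i div r) = (p - 1) * (r - 1)"
proof -
  have "r * (\<Sum>i<r. p * i div r) + (\<Sum>i<r. (0 + p * i) mod r) = p * (\<Sum>i<r. i)"
    by (simp add: sum_distrib_left flip: sum.distrib)
  then have "r * (2 * (\<Sum>i<r. p * i div r)) + 2 * (\<Sum>i<r. (0 + p * i) mod r) = p * (2 * (\<Sum>i<r. i))"
    by (metis distrib_left mult.left_commute)
  then have "r * (2 * (\<Sum>i<r. p * i div r)) + r * (r - 1) = p * (r * (r - 1))"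
    by (simp only: double_sum_affine_mod[OF assms] double_sum_lessThan)
  then have "r * (2 * (\<Sum>i<r. p * i div r) + (r - 1)) = r * (p * (r - 1))"
    by (simp add: algebra_simps)
  then have "2 * (\<Sum>i<r. p * i div r) + (r - 1) = p * (r - 1)"
    using \<open>r > 0\<close> by (metis mult_cancel1 neq0_conv)
  then show ?thesis
    by (simp add: diff_mult_distrib)
qed

text \<open>
  Writing \<open>r * c = p * u + v\<close> with \<open>v < p\<close>, the shifted digits are the numbers
  \<open>(p * j + v) div r\<close>, where \<open>j\<close> is the residue of \<open>i + u\<close> modulo \<open>r\<close>.
\<close>

lemma digit_sum_shift_floor_ge:
  fixes p r c :: nat
  assumes "coprime p r" and "p > 0" and "r > 0"
  shows "(p - 1) * (r - 1) \<le> 2 * (\<Sum>i<r. (p * i div r + c) mod p)"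
proof -
  define u v where "u = r * c div p" and "v = r * c mod p"
  have digit: "p * ((u + 1 * i) mod r) div r \<le> (p * i div r + c) mod p" for i
  proof -
    have "p * i div r + c = (p * i + r * c) div r"
      using \<open>r > 0\<close> by simp
    also have "p * i + r * c = p * (u + i) + v"
      by (simp add: u_def v_def algebra_simps)
    also have "\<dots> = r * (p * ((u + i) div r)) + (p * ((u + i) mod r) + v)"
      by (subst mult_div_mod_eq[of r "u + i", symmetric]) (simp only: algebra_simps)
    also have "\<dots> div r = p * ((u + i) div r) + (p * ((u + i) mod r) + v) div r"
      using \<open>r > 0\<close> by simp
    finally have "(p * i div r + c) mod p = (p * ((u + i) mod r) + v) div r mod p"
      by simp
    \<comment> \<open>The quotient is already below \<open>p\<close>, so the outer reduction does
      nothing. Dropping \<open>v\<close> from it then gives the lower bound.\<close>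
    also have "(p * ((u + i) mod r) + v) div r < p"
    proof -
      have "(u + i) mod r \<le> r - 1" "v < p"
        using \<open>r > 0\<close> \<open>p > 0\<close> by (simp_all add: v_def less_eq_Suc_le[symmetric] Suc_le_eq flip: less_Suc_eq_le)
      then have "p * ((u + i) mod r) + v < p * (r - 1) + p"
        by (intro add_le_less_mono mult_le_mono2)
      also have "\<dots> = p * r"
        using \<open>r > 0\<close> by (cases r) auto
      finally show ?thesis
        by (simp add: less_mult_imp_div_less)
    qed
    then have "(p * ((u + i) mod r) + v) div r mod p = (p * ((u + i) mod r) + v) div r"
      by simp
    finally show ?thesis
      by (simp add: div_le_mono)
  qed
  \<comment> \<open>The cyclic shift by \<open>u\<close> only permutes the floor digits.\<close>
  have "(\<Sum>i<r. p * i div r) = (\<Sum>i<r. p * ((u + 1 * i) mod r) div r)"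
    using sum.reindex_bij_betw[OF bij_betw_affine_mod[of 1 r u], of "\<lambda>i. p * i div r"] \<open>r > 0\<close>
    by simp
  also have "\<dots> \<le> (\<Sum>i<r. (p * i div r + c) mod p)"
    by (intro sum_mono digit)
  finally show ?thesis
    using double_sum_floor[OF assms(1,3)] by linarith
qed

section \<open>Finite fields with a root of unity of order \<open>r\<close>\<close>

lemma (in monoid) nat_pow_mod:
  fixes i n :: nat
  assumes "x \<in> carrier G" and "x [^] n = \<one>"
  shows "x [^] (i mod n) = x [^] i"
proof -
  have "x [^] i = x [^] (n * (i div n) + i mod n)"
    by simp
  also have "\<dots> = (x [^] n) [^] (i div n) \<otimes> x [^] (i mod n)"
    using assms(1) by (simp only: nat_pow_mult nat_pow_pow)
  finally show ?thesis
    using assms by simp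
qed

text \<open>Since \<open>r\<close> is prime, the last two assumptions give \<open>z\<close> the
  exact order \<open>r\<close>. Such a \<open>z\<close> is supplied later by
  \<open>image_power_eq_roots_of_unity\<close>.\<close>

locale primroot_field = field R for R (structure) +
  fixes p r :: nat and z :: 'a
  assumes p_prime: "prime p" and r_prime: "prime r"
    and primroot: "residue_primroot r p"
    and order_R: "order R = p ^ (r - 1)"
    and z_carrier [simp, intro]: "z \<in> carrier R"
    and z_pow_r: "z [^] r = \<one>" and z_neq_one: "z \<noteq> \<one>"
begin

lemma p_pos: "p > 0" and r_pos: "r > 0"
  using p_prime r_prime by (simp_all add: prime_gt_0_nat)

lemma coprime_rp: "coprime r p"
  using primroot by (simp add: residue_primroot_def)

lemma finite_carrier: "finite (carrier R)"
  using order_R p_pos by (metis card.infinite order_def power_eq_0_iff less_irrefl)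

text \<open>The order of the field is a power of \<open>p\<close> and annihilates
  \<open>\<one>\<close>, so \<open>[p] \<cdot> \<one>\<close> is nilpotent, hence zero in a
  field.\<close>

lemma add_pow_char: 
  assumes x: "x \<in> carrier R"
  shows "[p] \<cdot> x = \<zero>"
proof -
  have pow: "[(p ^ n)] \<cdot> \<one> = ([p] \<cdot> \<one>) [^] n" for n
  proof (induction n)
    case (Suc n)
    have "[(p ^ Suc n)] \<cdot> \<one> = [p] \<cdot> ([(p ^ n)] \<cdot> \<one>)"
      by (simp add: add.nat_pow_pow mult.commute)
    also have "\<dots> = ([p] \<cdot> \<one>) [^] n \<otimes> ([p] \<cdot> \<one>)"
      using add_pow_rdistr[of "([p] \<cdot> \<one>) [^] n" \<one> p] by (simp add: Suc)
    finally show ?case by simp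
  qed simp
  have "[(order R)] \<cdot> \<one> = \<zero>"
    using add.pow_order_eq_1[of \<one>] by (simp add: order_def)
  then have "([p] \<cdot> \<one>) [^] (r - 1) = \<zero>"
    by (simp add: order_R pow)
  moreover have "e [^] n \<noteq> \<zero>" if "e \<in> carrier R" "e \<noteq> \<zero>" for e and n :: nat
    using that by (induction n) (auto simp: integral_iff)
  ultimately have "[p] \<cdot> \<one> = \<zero>"
    by blast
  then show ?thesis
    using add_pow_ldistr[of \<one> x p] x by simp
qed

lemma add_pow_mod:
  assumes x: "x \<in> carrier R"
  shows "[(n mod p)] \<cdot> x = [n] \<cdot> x"
proof -
  have "[n] \<cdot> x = [(p * (n div p) + n mod p)] \<cdot> x"
    by simp
  also have "\<dots> = [(n div p)] \<cdot> ([p] \<cdot> x) \<oplus> [(n mod p)] \<cdot> x"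
    using x by (simp only: add.nat_pow_mult add.nat_pow_pow)
  finally show ?thesis
    using x by (simp add: add_pow_char)
qed

lemma z_pow_mod: "z [^] (n mod r) = z [^] n"
  by (simp add: nat_pow_mod z_pow_r)

text \<open>Otherwise \<open>n\<close> has an inverse \<open>m\<close> modulo the prime
  \<open>r\<close>, and \<open>z = z [^] (n * m) = \<one>\<close>.\<close>

lemma dvd_if_z_pow_eq_one:
  assumes "z [^] n = \<one>"
  shows "r dvd n"
proof (rule ccontr)
  assume "\<not> r dvd n"
  then have "coprime r n"
    using r_prime by (simp add: prime_imp_coprime)
  then obtain m where "[n * m = 1] (mod r)"
    using cong_solve_coprime_nat[of n r] by (auto simp: coprime_commute)
  then have "z [^] (n * m) = z [^] (1 :: nat)"
    by (metis cong_def z_pow_mod)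
  moreover have "z [^] (n * m) = \<one>"
    using assms by (simp flip: nat_pow_pow)
  ultimately show False
    using z_neq_one by simp
qed

text \<open>Geometric sum: multiplication by \<open>z\<close> fixes it because
  \<open>z [^] r = \<one>\<close>, and \<open>z \<noteq> \<one>\<close> can be cancelled.\<close>

lemma z_pow_sum_eq_zero: "(\<Oplus>j\<in>{..<r}. z [^] j) = \<zero>"
proof -
  define S where "S n = (\<Oplus>j\<in>{..<n}. z [^] j)" for n :: nat
  have S [simp]: "S n \<in> carrier R" for n
    by (simp add: S_def)
  have S_Suc: "S (Suc n) = z [^] n \<oplus> S n" for n
    unfolding S_def lessThan_Suc by (rule finsum_insert) auto
  have "z \<otimes> S n \<oplus> \<one> = S n \<oplus> z [^] n" for n
  proof (induction n)
    case 0
    then show ?case by (simp add: S_def)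
  next
    case (Suc n)
    have "z \<otimes> S (Suc n) \<oplus> \<one> = z [^] Suc n \<oplus> (z \<otimes> S n \<oplus> \<one>)"
      by (simp add: S_Suc r_distr a_assoc m_comm)
    also have "\<dots> = S (Suc n) \<oplus> z [^] Suc n"
      by (subst Suc) (simp add: S_Suc a_ac)
    finally show ?case .
  qed
  from this[of r] have "z \<otimes> S r = \<one> \<otimes> S r"
    by (simp add: z_pow_r)
  then have "S r = \<zero>"
    using z_neq_one m_rcancel by (metis S one_closed z_carrier)
  then show ?thesis
    by (simp add: S_def)
qed

section \<open>Combinations of the powers of \<open>z\<close>\<close>

text \<open>The coefficients are natural numbers rather than residues modulo \<open>p\<close>, so
  that their sum counts the powers of \<open>z\<close> used as summands.\<close>

definition comb :: "(nat \<Rightarrow> nat) \<Rightarrow> 'a" where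
  "comb n = (\<Oplus>j\<in>{..<r}. [n j] \<cdot> (z [^] j))"

lemma comb_closed [simp, intro]: "comb n \<in> carrier R"
  by (auto simp: comb_def)

lemma comb_add: "comb (\<lambda>j. n j + m j) = comb n \<oplus> comb m"
  unfolding comb_def by (subst finsum_addf[symmetric]) (auto simp: add.nat_pow_mult)

lemma comb_cong:
  assumes "\<And>j. j < r \<Longrightarrow> n j mod p = m j mod p"
  shows "comb n = comb m"
  unfolding comb_def
proof (rule finsum_cong')
  fix j assume "j \<in> {..<r}"
  then show "[n j] \<cdot> (z [^] j) = [m j] \<cdot> (z [^] j)"
    using assms by (metis add_pow_mod lessThan_iff nat_pow_closed z_carrier)
qed auto

lemma comb_zero: "comb (\<lambda>_. 0) = \<zero>"
  by (simp add: comb_def)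

lemma comb_const: "comb (\<lambda>_. c) = \<zero>"
proof (induction c)
  case (Suc c)
  have "comb (\<lambda>_. 1) = \<zero>"
    by (simp add: comb_def z_pow_sum_eq_zero)
  then show ?case
    using Suc comb_add[of "\<lambda>_. 1" "\<lambda>_. c"] by simp
qed (rule comb_zero)

lemma comb_shift: "comb (\<lambda>j. n j + c) = comb n"
  by (simp add: comb_add comb_const)

lemma comb_single:
  assumes "i < r"
  shows "comb (\<lambda>j. if j = i then 1 else 0) = z [^] i"
proof -
  have "comb (\<lambda>j. if j = i then 1 else 0) = (\<Oplus>j\<in>{..<r}. if i = j then z [^] j else \<zero>)"
    unfolding comb_def by (intro finsum_cong') auto
  also have "\<dots> = z [^] i"
    using assms by (intro add.finprod_singleton) auto
  finally show ?thesis .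
qed

text \<open>
  The additive subgroup generated by the powers of \<open>z\<close> is a subfield with \<open>p ^ d\<close> elements, and
  \<open>z\<close> has order \<open>r\<close>, so \<open>r\<close> divides \<open>p ^ d - 1\<close>. As \<open>p\<close> is a primitive root, \<open>d\<close> is a multiple
  of \<open>r - 1\<close>.
\<close>

lemma comb_surj:
  assumes "a \<in> carrier R"
  shows "\<exists>n. a = comb n"
proof -
  define Z where "Z = range (\<lambda>i :: nat. z [^] i)"
  define S where "S = generate (add_monoid R) Z"
  have Z_sub: "Z \<subseteq> carrier R"
    by (auto simp: Z_def)
  have sub: "subgroup S (add_monoid R)"
    unfolding S_def by (rule add.generate_is_subgroup) (use Z_sub in simp)
  have S_sub: "S \<subseteq> carrier R"
    using subgroup.subset[OF sub] by simp
  have S_zero: "\<zero> \<in> S"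
    using subgroup.one_closed[OF sub] by simp
  have S_add: "x \<oplus> y \<in> S" if "x \<in> S" "y \<in> S" for x y
    using subgroup.m_closed[OF sub that] by simp
  have S_neg: "\<ominus> x \<in> S" if "x \<in> S" for x
    using subgroup.m_inv_closed[OF sub that] by (simp add: a_inv_def)
  have S_Z: "z [^] i \<in> S" for i :: nat
    unfolding S_def Z_def by (rule generate.incl) simp
  \<comment> \<open>Closure under multiplication is shown first for one factor a power of
    \<open>z\<close>, then extended additively to all of \<open>S\<close>.\<close>
  have mult_Z: "z [^] i \<otimes> x \<in> S" if "x \<in> S" for i :: nat and x
    using that unfolding S_def
  proof (induction x rule: generate.induct)
    case (incl h)
    then obtain j :: nat where "h = z [^] j" by (auto simp: Z_def)
    then show ?case
      using S_Z[of "i + j"] by (simp add: nat_pow_mult S_def)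
  next
    case (inv h)
    then obtain j :: nat where "h = z [^] j" by (auto simp: Z_def)
    then show ?case
      using S_neg[OF S_Z[of "i + j"]]
      by (simp add: nat_pow_mult[symmetric] S_def r_minus a_inv_def[symmetric])
  next
    case (eng h1 h2)
    then have "h1 \<in> carrier R" "h2 \<in> carrier R"
      using S_sub by (auto simp: S_def)
    then show ?case
      using eng S_add by (simp add: S_def r_distr)
  qed (use S_zero in \<open>simp add: S_def\<close>)
  have S_mult: "y \<otimes> x \<in> S" if "x \<in> S" "y \<in> S" for x y
    using that(2) unfolding S_def
  proof (induction y rule: generate.induct)
    case (incl h)
    then show ?case
      using mult_Z[OF that(1)] by (auto simp: Z_def S_def)
  next
    case (inv h)
    then have "h \<in> carrier R" using Z_sub by auto
    then show ?case
      using S_neg[OF mult_Z[OF that(1)]] inv that(1) S_sub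
      by (auto simp: Z_def S_def l_minus a_inv_def[symmetric])
  next
    case (eng h1 h2)
    then have "h1 \<in> carrier R" "h2 \<in> carrier R"
      using S_sub by (auto simp: S_def)
    moreover have "x \<in> carrier R" using that(1) S_sub by blast
    ultimately show ?case
      using eng S_add by (simp add: S_def l_distr)
  qed (use S_zero that(1) S_sub in \<open>auto simp: S_def\<close>)

  interpret M: group "mult_of R"
    by (rule field_mult_group)
  have fin_S: "finite S"
    using finite_subset[OF S_sub finite_carrier] .
  have one_S: "\<one> \<in> S"
    using S_Z[of 0] by simp
  have pow_S: "x [^] n \<in> S" if "x \<in> S" for x and n :: nat
    by (induction n) (use one_S S_mult that in auto)
  have sub_mult: "subgroup (S - {\<zero>}) (mult_of R)"
  proof (rule M.subgroupI)
    show "S - {\<zero>} \<subseteq> carrier (mult_of R)"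
      using S_sub by auto
    show "S - {\<zero>} \<noteq> {}"
      using one_S by auto
    show "x \<otimes>\<^bsub>mult_of R\<^esub> y \<in> S - {\<zero>}" if "x \<in> S - {\<zero>}" "y \<in> S - {\<zero>}" for x y
      using that S_mult S_sub by (auto simp: integral_iff subset_iff)
    show "inv\<^bsub>mult_of R\<^esub> x \<in> S - {\<zero>}" if x: "x \<in> S - {\<zero>}" for x
    proof -
      have xc: "x \<in> carrier (mult_of R)"
        using x S_sub by auto
      have pos: "order (mult_of R) > 0"
        using M.order_gt_0_iff_finite finite_mult_of[OF finite_carrier] by blast
      \<comment> \<open>In a finite group the inverse is itself a power, so multiplicative closure
        of \<open>S\<close> already yields inverses.\<close>
      have "x [^]\<^bsub>mult_of R\<^esub> (order (mult_of R) - 1) \<otimes>\<^bsub>mult_of R\<^esub> x = \<one>\<^bsub>mult_of R\<^esub>"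
        using M.nat_pow_Suc[of x "order (mult_of R) - 1"] M.pow_order_eq_1[OF xc] pos
        by simp
      then have "inv\<^bsub>mult_of R\<^esub> x = x [^]\<^bsub>mult_of R\<^esub> (order (mult_of R) - 1)"
        using xc M.nat_pow_closed[OF xc] by (intro M.inv_equality) auto
      then have "inv\<^bsub>mult_of R\<^esub> x \<in> S"
        using pow_S x by (simp add: nat_pow_mult_of)
      moreover have "inv\<^bsub>mult_of R\<^esub> x \<in> carrier (mult_of R)"
        using xc by (rule M.inv_closed)
      ultimately show ?thesis by simp
    qed
  qed
  interpret H: group "(mult_of R)\<lparr>carrier := S - {\<zero>}\<rparr>"
    using M.subgroup_imp_group[OF sub_mult] .
  have z_nz: "z \<noteq> \<zero>"
    using z_pow_r r_pos by (auto simp: nat_pow_zero)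
  have "z [^]\<^bsub>(mult_of R)\<lparr>carrier := S - {\<zero>}\<rparr>\<^esub> card (S - {\<zero>}) = \<one>"
    using H.pow_order_eq_1[of z] S_Z[of 1] z_nz by (simp add: order_def)
  then have "z [^] card (S - {\<zero>}) = \<one>"
    by (simp add: nat_pow_def mult_of_def)
  then have r_dvd: "r dvd card S - 1"
    using dvd_if_z_pow_eq_one S_zero fin_S by (simp add: card_Diff_singleton)

  have "card (rcosets\<^bsub>add_monoid R\<^esub> S) * card S = order R"
    using add.lagrange[OF sub] by (simp add: order_def)
  then have "card S dvd p ^ (r - 1)"
    by (metis dvd_triv_right order_R)
  then obtain d where d: "d \<le> r - 1" "card S = p ^ d"
    using divides_primepow_nat[OF p_prime] by blast
  \<comment> \<open>The case \<open>d = 0\<close> must be excluded separately, because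
    \<open>ord r p\<close> divides \<open>0\<close>.\<close>
  have "card {\<zero>, \<one>} \<le> card S"
    by (rule card_mono) (use fin_S S_zero one_S in auto)
  then have "d \<noteq> 0"
    using d by (auto intro: Nat.gr0I)
  have "[p ^ d = 1] (mod r)"
    using r_dvd d p_pos by (metis cong_altdef_nat nat_one_le_power less_eq_Suc_le One_nat_def)
  then have "ord r p dvd d"
    by (simp only: ord_divides)
  moreover have "ord r p = r - 1"
    using primroot r_prime by (simp add: residue_primroot_def totient_prime)
  ultimately have "d = r - 1"
    using d \<open>d \<noteq> 0\<close> by (auto dest: dvd_imp_le)
  then have "S = carrier R"
    using d order_R by (intro card_subset_eq finite_carrier S_sub) (simp add: order_def)
  with assms have "a \<in> S" by simp
  \<comment> \<open>The factor \<open>p - 1\<close> acts as \<open>-1\<close>, which keeps the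
    coefficients natural.\<close>
  have neg_comb: "\<ominus> comb n = comb (\<lambda>j. (p - 1) * n j)" for n
  proof -
    have "comb (\<lambda>j. (p - 1) * n j) \<oplus> comb n = comb (\<lambda>j. (p - 1) * n j + n j)"
      by (simp add: comb_add)
    also have "\<dots> = comb (\<lambda>_. 0)"
      using p_pos by (intro comb_cong) (cases p, auto simp: algebra_simps simp flip: mult_Suc)
    finally show ?thesis
      by (simp add: comb_zero minus_equality)
  qed
  have comb_Z: "\<exists>n. z [^] i = comb n" for i :: nat
    using comb_single[of "i mod r"] r_pos by (metis mod_less_divisor z_pow_mod)
  from \<open>a \<in> S\<close> show ?thesis
    unfolding S_def
  proof (induction a rule: generate.induct)
    case one
    then show ?case using comb_zero by (metis monoid.simps(2))
  next
    case (incl h)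
    then show ?case using comb_Z by (auto simp: Z_def)
  next
    case (inv h)
    then obtain n where "h = comb n"
      using comb_Z by (auto simp: Z_def)
    then have "inv\<^bsub>add_monoid R\<^esub> h = comb (\<lambda>j. (p - 1) * n j)"
      using neg_comb by (simp add: a_inv_def)
    then show ?case by blast
  next
    case (eng h1 h2)
    then show ?case using comb_add by (metis monoid.simps(1))
  qed
qed

text \<open>
  Shifting makes the coefficient of \<open>z [^] 0\<close> vanish; the \<open>p ^ (r - 1)\<close> normalised combinations
  already exhaust the field, hence are distinct.
\<close>

lemma comb_eq_imp_shift:
  assumes "comb n = comb m"
  shows "\<exists>c. \<forall>j<r. n j mod p = (m j + c) mod p"
proof -
  define D where "D = PiE {1..<r} (\<lambda>_. {..<p})"
  define ext where "ext f = (\<lambda>j :: nat. if j = 0 then 0 else f j :: nat)" for f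
  \<comment> \<open>Adding \<open>(p - 1) * n 0\<close> subtracts \<open>n 0\<close> from every
    coefficient modulo \<open>p\<close>. Position \<open>0\<close> becomes zero and is left out of
    \<open>N\<close>; \<open>ext\<close> puts it back.\<close>
  define N where "N n = restrict (\<lambda>j. (n j + (p - 1) * n 0) mod p) {1..<r}" for n :: "nat \<Rightarrow> nat"
  have ND: "N n \<in> D" for n
    using p_pos by (auto simp: N_def D_def)
  have zero: "n 0 + (p - 1) * n 0 = p * n 0" for n :: "nat \<Rightarrow> nat"
    using p_pos by (cases p) auto
  have comb_N: "comb (ext (N n)) = comb n" for n
  proof -
    have "comb (ext (N n)) = comb (\<lambda>j. n j + (p - 1) * n 0)"
      using zero[of n] by (intro comb_cong) (auto simp: ext_def N_def)
    then show ?thesis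
      by (simp add: comb_shift)
  qed
  have "(\<lambda>f. comb (ext f)) ` D = carrier R"
  proof
    show "carrier R \<subseteq> (\<lambda>f. comb (ext f)) ` D"
      using comb_surj comb_N ND by (metis (no_types, lifting) image_eqI subsetI)
  qed auto
  moreover have "card D = p ^ (r - 1)"
    by (simp add: D_def card_PiE)
  moreover have "finite D"
    by (simp add: D_def finite_PiE)
  \<comment> \<open>A surjection between finite sets of equal cardinality is injective.\<close>
  ultimately have "inj_on (\<lambda>f. comb (ext f)) D"
    using order_R by (intro eq_card_imp_inj_on) (auto simp: order_def)
  moreover have "comb (ext (N n)) = comb (ext (N m))"
    using assms by (simp add: comb_N)
  ultimately have NN: "N n = N m"
    using ND by (auto dest: inj_onD)
  \<comment> \<open>The shift is \<open>n 0 - m 0\<close> modulo \<open>p\<close>, written without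
    subtraction.\<close>
  have "n j mod p = (m j + ((p - 1) * m 0 + n 0)) mod p" if "j < r" for j
  proof -
    have eq: "(n j + (p - 1) * n 0) mod p = (m j + (p - 1) * m 0) mod p"
    proof (cases "j = 0")
      case True
      then show ?thesis by (simp only: zero mod_mult_self1_is_0)
    next
      case False
      then show ?thesis using fun_cong[OF NN, of j] that by (simp add: N_def)
    qed
    have "n j mod p = (n j + (n 0 + (p - 1) * n 0)) mod p"
      by (simp only: zero mod_mult_self2)
    also have "\<dots> = ((n j + (p - 1) * n 0) mod p + n 0) mod p"
      by (simp add: mod_simps ac_simps)
    also have "\<dots> = (m j + ((p - 1) * m 0 + n 0)) mod p"
      by (subst eq) (simp add: mod_simps ac_simps)
    finally show ?thesis .
  qed
  then show ?thesis by blast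
qed

section \<open>Sums of \<open>k\<close>th powers and their minimal length\<close>

text \<open>Each summand is zero or some \<open>z [^] i\<close>, so it adds nothing or one unit to
  coefficient \<open>i\<close>. Zero summands are why the coefficient sum is only bounded by
  \<open>s\<close>.\<close>

lemma sum_of_powers_iff_comb:
  fixes k :: nat
  assumes "k > 0"
    and powers: "(\<lambda>x. x [^] k) ` carrier R = insert \<zero> ((\<lambda>j. z [^] j) ` {..<r})"
  shows "(\<exists>x\<in>{1..s} \<rightarrow> carrier R. a = (\<Oplus>i\<in>{1..s}. x i [^] k)) \<longleftrightarrow>
         (\<exists>n. (\<Sum>j<r. n j) \<le> s \<and> a = comb n)"
proof (induction s arbitrary: a)
  case 0
  have "a = comb n \<longleftrightarrow> a = \<zero>" if "(\<Sum>j<r. n j) = 0" for n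
    using that comb_zero comb_cong[of n "\<lambda>_. 0"] by simp
  moreover have "(\<Sum>j<r. 0 :: nat) = 0"
    by simp
  ultimately have "(\<exists>n. (\<Sum>j<r. n j) = 0 \<and> a = comb n) \<longleftrightarrow> a = \<zero>"
    by blast
  moreover have "(\<exists>x. x \<in> {1..0 :: nat} \<rightarrow> carrier R)"
    by simp
  ultimately show ?case
    by simp
next
  case (Suc s)
  have step: "(\<Oplus>i\<in>{1..Suc s}. x i [^] k) = x (Suc s) [^] k \<oplus> (\<Oplus>i\<in>{1..s}. x i [^] k)"
    if "x \<in> {1..Suc s} \<rightarrow> carrier R" for x
    using that by (subst atLeastAtMostSuc_conv, simp, subst finsum_insert) (auto simp: Pi_iff)
  show ?case
  proof (intro iffI)
    assume "\<exists>x\<in>{1..Suc s} \<rightarrow> carrier R. a = (\<Oplus>i\<in>{1..Suc s}. x i [^] k)"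
    then obtain x where x: "x \<in> {1..Suc s} \<rightarrow> carrier R" and a: "a = (\<Oplus>i\<in>{1..Suc s}. x i [^] k)"
      by blast
    have "x \<in> {1..s} \<rightarrow> carrier R"
      using x by auto
    then obtain n where n: "(\<Sum>j<r. n j) \<le> s" "(\<Oplus>i\<in>{1..s}. x i [^] k) = comb n"
      using Suc.IH by blast
    have "x (Suc s) \<in> carrier R"
      using x by auto
    then consider "x (Suc s) [^] k = \<zero>" | i where "i < r" "x (Suc s) [^] k = z [^] i"
      using powers by blast
    then show "\<exists>n. (\<Sum>j<r. n j) \<le> Suc s \<and> a = comb n"
    proof cases
      case 1
      then have "a = comb n"
        unfolding a step[OF x] n(2) by simp
      then show ?thesis using n le_SucI by blast
    next
      case 2
      have "a = comb (\<lambda>j. (if j = i then 1 else 0) + n j)"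
        unfolding a step[OF x] n(2) 2(2) comb_add comb_single[OF 2(1)] ..
      moreover have "(\<Sum>j<r. (if j = i then 1 else 0) + n j) \<le> Suc s"
        using n 2 by (simp add: sum.distrib)
      ultimately show ?thesis by blast
    qed
  next
    assume "\<exists>n. (\<Sum>j<r. n j) \<le> Suc s \<and> a = comb n"
    then obtain n where n: "(\<Sum>j<r. n j) \<le> Suc s" and a: "a = comb n"
      by blast
    have "\<exists>y m. y \<in> carrier R \<and> (\<Sum>j<r. m j) \<le> s \<and> a = y [^] k \<oplus> comb m"
    proof (cases "\<exists>i<r. n i > 0")
      case True
      then obtain i where i: "i < r" "n i > 0" by blast
      \<comment> \<open>One unit of coefficient \<open>i\<close> is split off; a \<open>k\<close>th
        root of \<open>z [^] i\<close> becomes the new summand.\<close>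
      define m where "m = n(i := n i - 1)"
      have n_eq: "n = (\<lambda>j. (if j = i then 1 else 0) + m j)"
        using i by (auto simp: m_def)
      have "(\<Sum>j<r. n j) = Suc (\<Sum>j<r. m j)"
        using i by (simp add: arg_cong[OF n_eq, of "\<lambda>n. \<Sum>j<r. n j"] sum.distrib)
      then have "(\<Sum>j<r. m j) \<le> s"
        using n by simp
      moreover have "a = z [^] i \<oplus> comb m"
        unfolding a arg_cong[OF n_eq, of comb] comb_add comb_single[OF i(1)] ..
      moreover have "z [^] i \<in> (\<lambda>x. x [^] k) ` carrier R"
        using powers i by blast
      then obtain y where "y \<in> carrier R" "z [^] i = y [^] k"
        by auto
      ultimately show ?thesis
        by (intro exI[of _ y] exI[of _ m]) simp
    next
      case False
      then have "a = comb (\<lambda>_. 0)"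
        unfolding a by (intro comb_cong) auto
      then have "a = \<zero> [^] k \<oplus> comb (\<lambda>_. 0)"
        using \<open>k > 0\<close> by (simp add: nat_pow_zero)
      then show ?thesis
        by (intro exI[of _ \<zero>] exI[of _ "\<lambda>_. 0"]) simp
    qed
    then obtain y m where y: "y \<in> carrier R" and m: "(\<Sum>j<r. m j) \<le> s" and ay: "a = y [^] k \<oplus> comb m"
      by blast
    obtain x where x: "x \<in> {1..s} \<rightarrow> carrier R" "comb m = (\<Oplus>i\<in>{1..s}. x i [^] k)"
      using Suc.IH[of "comb m"] m by blast
    define x' where "x' = x(Suc s := y)"
    have x': "x' \<in> {1..Suc s} \<rightarrow> carrier R"
      using x(1) y by (auto simp: x'_def Pi_iff)
    moreover have "(\<Oplus>i\<in>{1..s}. x' i [^] k) = (\<Oplus>i\<in>{1..s}. x i [^] k)"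
      using x(1) by (intro finsum_cong') (auto simp: x'_def Pi_iff)
    then have "a = (\<Oplus>i\<in>{1..Suc s}. x' i [^] k)"
      unfolding step[OF x'] ay x(2) by (simp add: x'_def)
    ultimately show "\<exists>x\<in>{1..Suc s} \<rightarrow> carrier R. a = (\<Oplus>i\<in>{1..Suc s}. x i [^] k)"
      by blast
  qed
qed

text \<open>The element with floor digits forces the lower bound on \<open>g\<close>: by
  \<open>comb_eq_imp_shift\<close>, any other representation has at least the digit sum of some
  shift. Conversely, every element has a shift with small enough digit sum.\<close>

lemma all_sums_of_powers_iff:
  assumes "k > 0"
    and powers: "(\<lambda>x. x [^] k) ` carrier R = insert \<zero> ((\<lambda>j. z [^] j) ` {..<r})"
  shows "all_sums_of_powers R k g \<longleftrightarrow> (p - 1) * (r - 1) \<le> 2 * g"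
proof
  assume "all_sums_of_powers R k g"
  then obtain n where n: "(\<Sum>j<r. n j) \<le> g" "comb (\<lambda>j. p * j div r) = comb n"
    unfolding all_sums_of_powers_def using sum_of_powers_iff_comb[OF assms] by blast
  from comb_eq_imp_shift[OF n(2)[symmetric]] obtain c
    where c: "\<And>j. j < r \<Longrightarrow> n j mod p = (p * j div r + c) mod p" by blast
  have "(p - 1) * (r - 1) \<le> 2 * (\<Sum>j<r. (p * j div r + c) mod p)"
    using coprime_rp p_pos r_pos
    by (intro digit_sum_shift_floor_ge) (auto simp: coprime_commute)
  also have "(\<Sum>j<r. (p * j div r + c) mod p) = (\<Sum>j<r. n j mod p)"
    using c by simp
  also have "\<dots> \<le> (\<Sum>j<r. n j)"
    by (intro sum_mono) simp
  finally show "(p - 1) * (r - 1) \<le> 2 * g"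
    using n(1) by linarith
next
  assume g: "(p - 1) * (r - 1) \<le> 2 * g"
  show "all_sums_of_powers R k g"
    unfolding all_sums_of_powers_def
  proof
    fix a assume "a \<in> carrier R"
    then obtain n where "a = comb n"
      using comb_surj by blast
    obtain c where c: "2 * (\<Sum>j<r. (n j + c) mod p) \<le> (p - 1) * (r - 1)"
      using exists_shift_small_digit_sum[OF coprime_rp p_pos] by blast
    have "comb (\<lambda>j. (n j + c) mod p) = comb (\<lambda>j. n j + c)"
      by (rule comb_cong) simp
    then have "a = comb (\<lambda>j. (n j + c) mod p)"
      by (simp add: \<open>a = comb n\<close> comb_shift)
    moreover have "(\<Sum>j<r. (n j + c) mod p) \<le> g"
      using c g by linarith
    ultimately show "\<exists>x\<in>{1..g} \<rightarrow> carrier R. a = (\<Oplus>i\<in>{1..g}. x i [^] k)"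
      using sum_of_powers_iff_comb[OF assms] by blast
  qed
qed

end

section \<open>The \<open>k\<close>th powers in a finite field, and the Waring number\<close>

text \<open>The multiplicative group is cyclic of order \<open>k * r\<close>. For a generator
  \<open>g\<close>, the nonzero \<open>k\<close>th powers are the powers of
  \<open>z = g [^] k\<close>.\<close>

lemma (in field) image_power_eq_roots_of_unity:
  assumes fin: "finite (carrier R)" and kr: "k * r = order R - 1" and "k > 0" "r > 1"
  obtains z where "z \<in> carrier R" "z [^] r = \<one>" "z \<noteq> \<one>"
    "(\<lambda>x. x [^] k) ` carrier R = insert \<zero> ((\<lambda>j. z [^] j) ` {..<r})"
proof -
  interpret M: group "mult_of R"
    by (rule field_mult_group)
  have card: "card (carrier (mult_of R)) = k * r"
    using order_mult_of[OF fin] kr by (simp add: order_def)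
  obtain g where g: "g \<in> carrier (mult_of R)" "carrier (mult_of R) = {g [^] i | i :: nat. i \<in> UNIV}"
    using finite_field_mult_group_has_gen[OF fin] by blast
  then have gc [simp]: "g \<in> carrier R" by simp
  have g_pow: "g [^] (k * r) = \<one>"
    using M.pow_order_eq_1[OF g(1)] card by (simp add: order_def nat_pow_mult_of)
  define z where "z = g [^] k"
  have z [simp]: "z \<in> carrier R" by (simp add: z_def)
  have z_r: "z [^] r = \<one>"
    by (simp add: z_def nat_pow_pow g_pow)
  have "z \<noteq> \<one>"
  proof
    assume "z = \<one>"
    then have "g [^] k = \<one>" by (simp add: z_def)
    \<comment> \<open>If \<open>g [^] k = \<one>\<close>, at most \<open>k\<close> nonzero elements
      exist, fewer than \<open>k * r\<close>.\<close>
    have "carrier (mult_of R) \<subseteq> (\<lambda>i. g [^] i) ` {..<k}"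
    proof
      fix x assume "x \<in> carrier (mult_of R)"
      then obtain i :: nat where "x = g [^] i"
        using g(2) by blast
      then have "x = g [^] (i mod k)"
        using nat_pow_mod[OF gc \<open>g [^] k = \<one>\<close>] by simp
      then show "x \<in> (\<lambda>i. g [^] i) ` {..<k}"
        using \<open>k > 0\<close> by auto
    qed
    then have "k * r \<le> card ((\<lambda>i. g [^] i) ` {..<k})"
      unfolding card[symmetric] by (intro card_mono) auto
    also have "\<dots> \<le> k"
      using card_image_le[of "{..<k}" "\<lambda>i. g [^] i"] by simp
    finally show False
      using \<open>k > 0\<close> \<open>r > 1\<close> by simp
  qed
  moreover have "(\<lambda>x. x [^] k) ` carrier R = insert \<zero> ((\<lambda>j. z [^] j) ` {..<r})"
  proof (intro equalityI subsetI)
    fix y assume "y \<in> (\<lambda>x. x [^] k) ` carrier R"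
    then obtain x where x: "x \<in> carrier R" "y = x [^] k" by blast
    show "y \<in> insert \<zero> ((\<lambda>j. z [^] j) ` {..<r})"
    proof (cases "x = \<zero>")
      case True
      then show ?thesis using x \<open>k > 0\<close> by (simp add: nat_pow_zero)
    next
      case False
      then have "x \<in> carrier (mult_of R)" using x by simp
      then obtain i :: nat where "x = g [^] i"
        using g(2) by blast
      then have "y = z [^] i"
        by (simp add: x z_def nat_pow_pow mult.commute)
      then have "y = z [^] (i mod r)"
        using nat_pow_mod[OF z z_r] by simp
      then show ?thesis
        using \<open>r > 1\<close> by auto
    qed
  next
    fix y assume "y \<in> insert \<zero> ((\<lambda>j. z [^] j) ` {..<r})"
    then consider "y = \<zero>" | j :: nat where "y = z [^] j" by blast
    then show "y \<in> (\<lambda>x. x [^] k) ` carrier R"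
    proof cases
      case 1
      then have "y = \<zero> [^] k"
        using \<open>k > 0\<close> by (simp add: nat_pow_zero)
      then show ?thesis by blast
    next
      case 2
      then have "y = (g [^] j) [^] k"
        by (simp add: z_def nat_pow_pow mult.commute)
      then show ?thesis by (rule image_eqI) simp
    qed
  qed
  ultimately show thesis
    using that z z_r by blast
qed

theorem theorem1p2:
  fixes R :: "('a, 'b) ring_scheme" and p r :: nat
  assumes "prime p" and "prime r"
    and "residue_primroot r p"
    and "field R" and "order R = p ^ (r - 1)"
  shows "(\<exists>g>0. all_sums_of_powers R ((p ^ (r - 1) - 1) div r) g) \<and>
         real (waring_number R ((p ^ (r - 1) - 1) div r)) = (real p - 1) * (real r - 1) / 2"
proof -
  interpret field R by fact
  define k where "k = (p ^ (r - 1) - 1) div r"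
  have p: "p \<ge> 2" and r: "r \<ge> 2"
    using assms(1,2) by (simp_all add: prime_ge_2_nat)
  have fin: "finite (carrier R)"
    using assms(5) p by (intro card_ge_0_finite) (simp add: order_def)
  have cop: "coprime r p" and "ord r p = r - 1"
    using assms(2,3) by (simp_all add: residue_primroot_def totient_prime)
  then have "[p ^ (r - 1) = 1] (mod r)"
    by (metis dvd_refl ord_divides)
  then have "r dvd p ^ (r - 1) - 1"
    using p by (simp add: cong_altdef_nat)
  then have kr: "k * r = p ^ (r - 1) - 1"
    by (simp add: k_def)
  have "p ^ (r - 1) > 1"
    using p r by (intro one_less_power) auto
  then have "k > 0"
    using kr by (intro Nat.gr0I) auto
  have "k * r = order R - 1" "r > 1"
    using kr r assms(5) by simp_all
  then obtain z where z: "z \<in> carrier R" "z [^]\<^bsub>R\<^esub> r = \<one>\<^bsub>R\<^esub>" "z \<noteq> \<one>\<^bsub>R\<^esub>"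
    and powers: "(\<lambda>x. x [^]\<^bsub>R\<^esub> k) ` carrier R = insert \<zero>\<^bsub>R\<^esub> ((\<lambda>j. z [^]\<^bsub>R\<^esub> j) ` {..<r})"
    using image_power_eq_roots_of_unity[OF fin _ \<open>k > 0\<close>] by metis
  interpret primroot_field R p r z
    by unfold_locales (use assms z in auto)
  have iff: "all_sums_of_powers R k g \<longleftrightarrow> (p - 1) * (r - 1) \<le> 2 * g" for g
    by (rule all_sums_of_powers_iff[OF \<open>k > 0\<close> powers])
  define w where "w = (p - 1) * (r - 1) div 2"
  \<comment> \<open>Distinct primes are not both \<open>2\<close>, so
    \<open>(p - 1) * (r - 1)\<close> is even and the halving in \<open>w\<close> is exact.\<close>
  have "p \<noteq> r"
    using cop r by auto
  then have "odd p \<or> odd r"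
    using assms(1,2) by (metis primes_dvd_imp_eq two_is_prime_nat)
  then have w: "2 * w = (p - 1) * (r - 1)"
    using p r by (auto simp: w_def)
  \<comment> \<open>Positivity makes \<open>w\<close> admissible in \<open>waring_number\<close>,
    whose minimum ranges over positive \<open>g\<close>.\<close>
  have "w > 0"
    using w p r by (intro Nat.gr0I) auto
  have "waring_number R k = w"
    unfolding waring_number_def
    by (rule Least_equality) (use \<open>w > 0\<close> w in \<open>auto simp: iff\<close>)
  moreover have "real w = (real p - 1) * (real r - 1) / 2"
  proof -
    have "2 * real w = real ((p - 1) * (r - 1))"
      unfolding w[symmetric] by simp
    then show ?thesis
      using p r by (simp add: of_nat_diff)
  qed
  moreover have "all_sums_of_powers R k w"
    using w by (simp add: iff)
  ultimately show ?thesis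
    using \<open>w > 0\<close> unfolding k_def by auto
qed

end
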